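(* Let $k\in\mathbb{N}$ and $z\in\mathbb{C}$ with $\operatorname{Re}(z)<k$. For $x>0$, \[ K_z^{(k)}(x)=\int_0^\infty\exp\!\Big(-\frac{1}{t^k}\Big)\cos(xt)\,\frac{dt}{t^{k-z}}. \]
   Context: For $x>0$, $K_z^{(k)}(x):=\frac{1}{2\pi i}\int_{c-i\infty}^{c+i\infty}\Gamma(s)\cos\!\big(\frac{\pi s}{2}\big)\Gamma\!\big(\frac{s-1-z}{k}+1\big)\frac{ds}{k\,x^{s}}$ with any $c>\max\{0,1-k+\operatorname{Re}(z)\}$. *)

theory Defs
  imports "HOL-Analysis.Analysis"
begin

text \<open>
  The integral of \<open>f\<close> over the vertical line from \<open>c - \<i>\<infinity>\<close> to \<open>c + \<i>\<infinity>\<close>,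
  parametrised by \<open>s = c + \<i>y\<close>, so that \<open>ds = \<i> dy\<close>. It is a Lebesgue integral
  (and hence 0 by convention if \<open>f\<close> is not absolutely integrable on the line).
\<close>

definition vertical_line_integral :: "real \<Rightarrow> (complex \<Rightarrow> complex) \<Rightarrow> complex" where
  "vertical_line_integral c f = (LINT y|lborel. f (Complex c y) * \<i>)"

text \<open>
  The function \<open>K\<^sub>z\<^sup>(\<^sup>k\<^sup>)(x)\<close>. The abscissa \<open>c\<close> of the line of integration is kept as
  an argument; it is meant to be any real number \<open>c > max 0 (1 - k + Re z)\<close>. To the right of
  that bound the integrand has no poles, and it decays exponentially along vertical lines, so
  the value does not depend on the choice of \<open>c\<close>.
\<close>

definition K_fun :: "real \<Rightarrow> nat \<Rightarrow> complex \<Rightarrow> real \<Rightarrow> complex" where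
  "K_fun c k z x =
     1 / (2 * of_real pi * \<i>) *
     vertical_line_integral c
       (\<lambda>s. Gamma s * cos (of_real pi * s / 2) * Gamma ((s - 1 - z) / of_nat k + 1)
            / (of_nat k * of_real x powr s))"

end

theory Submission
  imports Defs "HOL-Probability.Probability"
begin

text \<open>
  The formal argument is Parseval for the Mellin transform, since \<open>\<Gamma>(s) cos(\<pi>s/2)\<close> is the transform of
  the cosine and \<open>\<Gamma>((s-1-z)/k+1)/k\<close> that of \<open>exp(-1/t\<^sup>k) t\<^sup>z\<^sup>-\<^sup>k\<close> at \<open>1 - s\<close>. As the cosine is not integrable, it is
  written as the mean of \<open>exp(-x w t)\<close> over \<open>w = cis \<theta>\<close> with \<open>\<theta> = \<plusminus>\<pi>/2\<close>, and for \<open>\<bar>\<theta>\<bar> < \<pi>/2\<close> everything converges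
  absolutely. The limit \<open>\<theta> \<rightarrow> \<plusminus>\<pi>/2\<close> is taken by dominated convergence: on the Mellin side with the
  bound \<open>\<bar>\<Gamma>(s)\<bar> \<le> C exp(-\<eta> \<bar>Im s\<bar>)\<close>, for every \<open>\<eta> < \<pi>/2\<close>, and on the other side after an integration by parts, which
  also turns the conditionally convergent integral into an absolutely convergent one. With \<open>t = e\<^sup>v\<close> the Mellin
  transform becomes the Fourier transform, whose inversion formula follows from Gaussian summation.
\<close>

section \<open>Euler's integral along rotated rays\<close>

text \<open>With t = exp v, Mellin transforms on the half-line become Fourier transforms on the
  whole line. The equivalence is used in both directions: to import Euler's integral, and at the end
  to return to the variable t.\<close>

lemma exp_substitution:
  fixes h :: "real \<Rightarrow> complex"
  shows "(\<lambda>v. exp v *\<^sub>R h (exp v)) absolutely_integrable_on UNIV \<and>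
           integral UNIV (\<lambda>v. exp v *\<^sub>R h (exp v)) = b
     \<longleftrightarrow> h absolutely_integrable_on {0<..} \<and> integral {0<..} h = b"
proof -
  have "(\<lambda>v. \<bar>exp v\<bar> *\<^sub>R h (exp v)) absolutely_integrable_on UNIV \<and>
          integral UNIV (\<lambda>v. \<bar>exp v\<bar> *\<^sub>R h (exp v)) = b
     \<longleftrightarrow> h absolutely_integrable_on (range exp) \<and> integral (range exp) h = b"
    by (rule has_absolute_integral_change_of_variables_real) (auto intro!: derivative_eq_intros inj_onI)
  moreover have "range (exp :: real \<Rightarrow> real) = {0<..}"
    using exp_total by (auto simp: image_iff)
  ultimately show ?thesis by simp
qed

lemma has_bochner_integral_exp_exp:
  assumes "Re s > 0"
  shows "has_bochner_integral lborel (\<lambda>v. of_real (exp (- exp v)) * exp (of_real v * s)) (Gamma s)"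
proof -
  let ?h = "\<lambda>t. complex_of_real t powr (s - 1) / of_real (exp t)"
  let ?g = "\<lambda>v. of_real (exp (- exp v)) * exp (complex_of_real v * s)"
  have eq: "exp v *\<^sub>R ?h (exp v) = ?g v" for v :: real
    by (simp add: powr_def exp_minus field_simps Ln_exp scaleR_conv_of_real flip: exp_add exp_of_real)
  have "?h absolutely_integrable_on {0<..} \<and> integral {0<..} ?h = Gamma s"
    using absolutely_integrable_Gamma_integral'[OF assms] Gamma_integral_complex'[OF assms]
    by (auto intro: integral_unique)
  then have *: "?g absolutely_integrable_on UNIV" "integral UNIV ?g = Gamma s"
    using exp_substitution[of ?h "Gamma s"] unfolding eq by auto
  \<comment> \<open>Absolute integrability refers to the completed measure; Borel measurability
    brings it down to \<open>lborel\<close>.\<close>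
  have "?g \<in> borel_measurable borel"
    by (intro borel_measurable_continuous_onI continuous_intros)
  then have "integrable lborel ?g"
    using *(1) by (simp add: set_integrable_def integrable_completion)
  then show ?thesis
    using *(2) integral_lborel[of ?g] by (simp add: has_bochner_integral_iff)
qed

lemma has_bochner_integral_exp_exp_real:
  fixes c :: real
  assumes "c > 0"
  shows "has_bochner_integral lborel (\<lambda>v. exp (- exp v) * exp (v * c)) (Gamma c)"
proof -
  have "has_bochner_integral lborel
     (\<lambda>v. Re (of_real (exp (- exp v)) * exp (of_real v * of_real c))) (Re (Gamma (complex_of_real c)))"
    by (rule has_bochner_integral_bounded_linear[OF bounded_linear_Re has_bochner_integral_exp_exp])
       (use assms in simp)
  moreover have "Re (of_real (exp (- exp v)) * exp (of_real v * of_real c)) = exp (- exp v) * exp (v * c)" for v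
    by (simp only: exp_of_real Re_complex_of_real flip: of_real_mult)
  ultimately show ?thesis
    by (simp add: Gamma_complex_of_real)
qed

text \<open>Expand exp((1 - w) exp v) in powers of 1 - w and integrate termwise. Each term is a
  shifted Euler integral, and the resulting series is the binomial series of w^(-s), whose disc of
  convergence is the condition on \<open>w\<close>.\<close>

lemma has_bochner_integral_exp_exp_near_1:
  assumes s: "Re s > 0" and w: "norm (1 - w) < 1"
  shows "has_bochner_integral lborel (\<lambda>v. exp (- w * of_real (exp v)) * exp (of_real v * s))
           (Gamma s * w powr (- s))"
proof -
  let ?f = "\<lambda>n v. of_real (exp (- exp v)) * exp (complex_of_real v * (s + of_nat n)) * ((1 - w) ^ n / fact n)"
  let ?c = "\<lambda>n. Gamma (s + of_nat n) * ((1 - w) ^ n / fact n)"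
  \<comment> \<open>Gamma(a + n) is the rising factorial of a times Gamma(a), and its quotient by n!
    is a binomial coefficient of -a up to the sign (-1)^n. Stated for general \<open>a\<close> and
    \<open>u\<close> because it serves the series itself and its majorant.\<close>
  have Gamma_gbinomial: "Gamma (a + of_nat n) * ((1 - u) ^ n / fact n) = Gamma a * ((- a gchoose n) * (u - 1) ^ n)"
    if "Re a > 0" for a u :: complex and n
  proof -
    have "a \<notin> \<int>\<^sub>\<le>\<^sub>0"
      using that by (auto elim!: nonpos_Ints_cases)
    then have "Gamma (a + of_nat n) = pochhammer a n * Gamma a"
      using pochhammer_Gamma[of a n] by (auto simp: Gamma_eq_zero_iff)
    moreover have "(1 - u) ^ n = (-1) ^ n * (u - 1) ^ n"
      by (simp flip: power_mult_distrib)
    ultimately show ?thesis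
      by (simp add: gbinomial_pochhammer)
  qed
  have f_int: "has_bochner_integral lborel (?f n) (?c n)" for n
    by (intro has_bochner_integral_mult_left has_bochner_integral_exp_exp) (use s in auto)
  have norm_f: "norm (?f n v) = exp (- exp v) * exp (v * (Re s + n)) * (norm (1 - w) ^ n / fact n)" for n v
    by (simp add: norm_mult norm_divide norm_power)
  have norm_int: "(LINT v|lborel. norm (?f n v)) = Gamma (Re s + n) * (norm (1 - w) ^ n / fact n)" for n
    unfolding norm_f
    by (intro has_bochner_integral_integral_eq has_bochner_integral_mult_left
         has_bochner_integral_exp_exp_real) (use s in auto)
  have sums: "(\<Sum>n. ?f n v) = exp (- w * of_real (exp v)) * exp (of_real v * s)
               \<and> summable (\<lambda>n. norm (?f n v))" for v
  proof -
    define y where "y = (1 - w) * of_real (exp v)"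
    have y_pow: "y ^ n = (1 - w) ^ n * exp (of_real v * of_nat n)" for n
      by (simp add: y_def power_mult_distrib exp_of_nat2_mult flip: exp_of_real)
    have f_eq: "?f n v = of_real (exp (- exp v)) * exp (of_real v * s) * (y ^ n /\<^sub>R fact n)" for n
      by (simp add: y_pow exp_add ring_distribs scaleR_conv_of_real divide_inverse mult_ac)
    have "(\<lambda>n. ?f n v) sums (of_real (exp (- exp v)) * exp (of_real v * s) * exp y)"
      unfolding f_eq by (intro sums_mult exp_converges)
    moreover have "of_real (exp (- exp v)) * exp y = exp (- w * of_real (exp v))"
      by (simp add: y_def ring_distribs flip: exp_of_real exp_add)
    moreover have "summable (\<lambda>n. norm (?f n v))"
      unfolding f_eq norm_mult by (intro summable_mult summable_norm_exp)
    ultimately show ?thesis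
      by (auto simp: sums_iff mult_ac)
  qed
  \<comment> \<open>The integrals of the norms form the same binomial series with \<open>s\<close>
    replaced by \<open>Re s\<close> and \<open>w\<close> by \<open>1 - norm (1 - w)\<close>, which
    lies in the same disc.\<close>
  have summ: "summable (\<lambda>n. LINT v|lborel. norm (?f n v))"
  proof -
    have "summable (\<lambda>n. (- complex_of_real (Re s) gchoose n) * (of_real (1 - norm (1 - w)) - 1) ^ n)"
      using gen_binomial_complex[of "of_real (1 - norm (1 - w)) - 1" "- of_real (Re s)"] w
      by (auto simp: sums_iff norm_minus_commute)
    then have "summable (\<lambda>n. Gamma (of_real (Re s) + of_nat n) *
                  ((1 - complex_of_real (1 - norm (1 - w))) ^ n / fact n))"
      by (subst Gamma_gbinomial) (use s in \<open>auto intro: summable_mult\<close>)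
    also have "(\<lambda>n. Gamma (of_real (Re s) + of_nat n) *
                  ((1 - complex_of_real (1 - norm (1 - w))) ^ n / fact n)) =
               (\<lambda>n. of_real (Gamma (Re s + n) * (norm (1 - w) ^ n / fact n)))"
    proof
      fix n
      have "Gamma (complex_of_real (Re s) + of_nat n) = of_real (Gamma (Re s + n))"
        using Gamma_complex_of_real[of "Re s + n"] by simp
      then show "Gamma (of_real (Re s) + of_nat n) *
                  ((1 - complex_of_real (1 - norm (1 - w))) ^ n / fact n) =
                 of_real (Gamma (Re s + n) * (norm (1 - w) ^ n / fact n))"
        by simp
    qed
    finally show ?thesis
      unfolding norm_int by (simp only: summable_complex_of_real)
  qed
  have "integrable lborel (\<lambda>v. \<Sum>n. ?f n v)"
    by (rule integrable_suminf) (use f_int sums summ in \<open>auto simp: has_bochner_integral_iff\<close>)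
  moreover have "(\<lambda>n. integral\<^sup>L lborel (?f n)) sums (LINT v|lborel. (\<Sum>n. ?f n v))"
    by (rule sums_integral) (use f_int sums summ in \<open>auto simp: has_bochner_integral_iff\<close>)
  moreover have "integral\<^sup>L lborel (?f n) = Gamma s * ((- s gchoose n) * (w - 1) ^ n)" for n
    unfolding has_bochner_integral_integral_eq[OF f_int] by (rule Gamma_gbinomial[OF s])
  moreover have "(\<lambda>n. Gamma s * ((- s gchoose n) * (w - 1) ^ n)) sums (Gamma s * w powr (- s))"
    using gen_binomial_complex[of "w - 1" "- s"] w by (intro sums_mult) (auto simp: norm_minus_commute)
  ultimately show ?thesis
    using sums by (auto simp: has_bochner_integral_iff sums_iff)
qed

text \<open>The dilates of the disc of radius 1 about 1 fill the right half-plane, and a positive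
  factor of \<open>w\<close> is a translation of \<open>v\<close> by its logarithm. So the previous
  case extends to every \<open>w\<close> with positive real part.\<close>

lemma has_bochner_integral_exp_exp_rotated:
  assumes s: "Re s > 0" and w: "Re w > 0"
  shows "has_bochner_integral lborel (\<lambda>v. exp (- w * of_real (exp v)) * exp (of_real v * s))
           (Gamma s * w powr (- s))"
proof -
  \<comment> \<open>\<open>w / a\<close> lies in the disc about 1 iff a^2 - 2 a Re w + |w|^2 < a^2,
    that is a > |w|^2 / (2 Re w); this is twice the threshold.\<close>
  define a where "a = (norm w)\<^sup>2 / Re w"
  have w0: "w \<noteq> 0" using w by auto
  have a: "a > 0" using w w0 by (simp add: a_def)
  define u where "u = w / of_real a"
  have u: "norm (1 - u) < 1"
  proof -
    have "(norm (of_real a - w))\<^sup>2 = a\<^sup>2 - 2 * a * Re w + (norm w)\<^sup>2"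
      unfolding cmod_power2 by (simp add: power2_eq_square algebra_simps)
    also have "\<dots> < a\<^sup>2"
      using w w0 by (simp add: a_def)
    finally have "norm (of_real a - w) < a"
      using a power_less_imp_less_base by fastforce
    moreover have "1 - u = (of_real a - w) / of_real a"
      using a by (simp add: u_def field_simps)
    ultimately show ?thesis using a by (simp add: norm_divide)
  qed
  let ?F = "\<lambda>v. exp (- u * of_real (exp v)) * exp (of_real v * s)"
  have "has_bochner_integral lborel (\<lambda>v. ?F (ln a + 1 * v)) ((Gamma s * u powr (- s)) /\<^sub>R \<bar>1\<bar>)"
    by (subst lborel_has_bochner_integral_real_affine_iff[where c=1 and t="ln a", symmetric])
       (use has_bochner_integral_exp_exp_near_1[OF s u] in auto)
  then have "has_bochner_integral lborel (\<lambda>v. ?F (ln a + v) * of_real a powr (- s))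
     (Gamma s * u powr (- s) * of_real a powr (- s))"
    by (intro has_bochner_integral_mult_left) simp
  moreover have "?F (ln a + v) * of_real a powr (- s) = exp (- w * of_real (exp v)) * exp (of_real v * s)" for v
  proof -
    have "u * of_real (exp (ln a + v)) = w * of_real (exp v)"
      using a by (simp add: u_def exp_add)
    moreover have "exp (of_real (ln a + v) * s) * of_real a powr (- s) = exp (of_real v * s)"
      using a by (simp add: powr_def ring_distribs Ln_of_real flip: exp_add)
    ultimately show ?thesis by (simp add: mult_ac)
  qed
  moreover have "u powr (- s) * of_real a powr (- s) = w powr (- s)"
    using powr_times_real_left[of "of_real a" u "- s"] a by (simp add: u_def mult.commute)
  ultimately show ?thesis by (simp add: mult.assoc)
qed

lemma has_bochner_integral_exp_exp_scaled_real:
  fixes c r :: real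
  assumes "c > 0" "r > 0"
  shows "has_bochner_integral lborel (\<lambda>v. exp (- r * exp v) * exp (v * c)) (Gamma c * r powr (- c))"
proof -
  have "has_bochner_integral lborel
     (\<lambda>v. Re (exp (- of_real r * of_real (exp v)) * exp (of_real v * of_real c)))
     (Re (Gamma (complex_of_real c) * of_real r powr (- of_real c)))"
    by (rule has_bochner_integral_bounded_linear[OF bounded_linear_Re has_bochner_integral_exp_exp_rotated])
       (use assms in simp_all)
  moreover have "Re (exp (- of_real r * of_real (exp v)) * exp (of_real v * of_real c)) =
      exp (- r * exp v) * exp (v * c)" for v
    by (simp only: exp_of_real Re_complex_of_real flip: of_real_mult of_real_minus)
  moreover have "Re (Gamma (complex_of_real c) * of_real r powr (- of_real c)) = Gamma c * r powr (- c)"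
    using assms
    by (simp only: Gamma_complex_of_real powr_of_real less_imp_le Re_complex_of_real flip: of_real_mult of_real_minus)
  ultimately show ?thesis by simp
qed

section \<open>Exponential decay of Gamma on vertical lines\<close>

lemma norm_cis_powr:
  assumes "\<bar>\<theta>\<bar> < pi"
  shows "norm (cis \<theta> powr s) = exp (- \<theta> * Im s)"
proof -
  have "Ln (cis \<theta>) = \<i> * of_real \<theta>"
    using assms by (simp add: cis_conv_exp Ln_exp)
  then show ?thesis
    by (simp add: powr_def)
qed

lemma Re_cis_pos: "\<bar>\<theta>\<bar> < pi / 2 \<Longrightarrow> Re (cis \<theta>) > 0"
  by (simp add: cos_gt_zero_pi)

text \<open>Rotating the contour in Euler's integral by the angle \<open>\<theta>\<close> gains the factor \<open>exp (- \<theta> * \<bar>Im s\<bar>)\<close>.\<close>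

lemma norm_Gamma_vertical_le:
  assumes s: "Re s > 0" and \<theta>: "0 \<le> \<theta>" "\<theta> < pi / 2"
  shows "norm (Gamma s) \<le> Gamma (Re s) * cos \<theta> powr (- Re s) * exp (- \<theta> * \<bar>Im s\<bar>)"
proof -
  \<comment> \<open>The sign of the rotation follows that of \<open>Im s\<close>, so that |(cis
    \<phi>)^(-s)| = exp(\<phi> Im s) is large on both halves of the line.\<close>
  define \<phi> where "\<phi> = (if Im s \<ge> 0 then \<theta> else - \<theta>)"
  have \<phi>: "\<bar>\<phi>\<bar> < pi / 2" "cos \<phi> = cos \<theta>" "\<phi> * Im s = \<theta> * \<bar>Im s\<bar>"
    using \<theta> by (auto simp: \<phi>_def)
  have cos_pos: "cos \<theta> > 0"
    using \<theta> by (intro cos_gt_zero_pi) auto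
  note int = has_bochner_integral_exp_exp_rotated[OF s Re_cis_pos[OF \<phi>(1)]]
  have norm_eq: "norm (exp (- cis \<phi> * of_real (exp v)) * exp (of_real v * s)) = exp (- cos \<theta> * exp v) * exp (v * Re s)" for v
    by (simp add: norm_mult \<phi>)
  have "norm (Gamma s * cis \<phi> powr (- s)) \<le> (LINT v|lborel. exp (- cos \<theta> * exp v) * exp (v * Re s))"
    using integral_norm_bound[of lborel "\<lambda>v. exp (- cis \<phi> * of_real (exp v)) * exp (of_real v * s)"]
    unfolding has_bochner_integral_integral_eq[OF int] norm_eq .
  also have "\<dots> = Gamma (Re s) * cos \<theta> powr (- Re s)"
    using has_bochner_integral_exp_exp_scaled_real[OF s cos_pos] has_bochner_integral_integral_eq by blast
  also have "norm (Gamma s * cis \<phi> powr (- s)) = norm (Gamma s) * exp (\<theta> * \<bar>Im s\<bar>)"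
    using \<phi> norm_cis_powr[of \<phi> "- s"] by (simp add: norm_mult)
  finally show ?thesis
    by (simp add: exp_minus field_simps)
qed

lemma integrable_exp_neg_abs:
  fixes a :: real
  assumes "a > 0"
  shows "integrable lborel (\<lambda>y. exp (- a * \<bar>y\<bar>))"
proof -
  let ?f = "\<lambda>y. indicat_real {0<..} y * exp (- (y * a))"
  have f: "integrable lborel ?f"
    using integrable_I0i_exp_mscale[OF assms] by (simp add: set_integrable_def)
  have "integrable lborel (\<lambda>y. ?f (0 + (- 1) * y))"
    by (rule lborel_integrable_real_affine[OF f]) simp
  with f have "integrable lborel (\<lambda>y. ?f y + ?f (0 + (- 1) * y))"
    by (rule Bochner_Integration.integrable_add)
  \<comment> \<open>At 0 both indicators vanish, so the identity holds only off that point.\<close>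
  moreover have "AE y in lborel. ?f y + ?f (0 + (- 1) * y) = exp (- a * \<bar>y\<bar>)"
    using AE_lborel_singleton[of 0] by eventually_elim (auto simp: indicator_def mult_ac)
  ultimately show ?thesis
    by (subst integrable_cong_AE[symmetric]) auto
qed

section \<open>Fourier inversion\<close>

lemma borel_measurable_cis [measurable]: "cis \<in> borel_measurable borel"
  by (intro borel_measurable_continuous_onI continuous_intros)

lemma integrable_mult_cis:
  assumes "integrable lborel a"
  shows "integrable lborel (\<lambda>v. a v * cis (y * v))"
  using assms by (rule Bochner_Integration.integrable_bound) (use borel_measurable_integrable[OF assms] in \<open>auto simp: norm_mult\<close>)

text \<open>Fubini: the kernel \<open>cis (y * v)\<close> has modulus 1, so the product of
  \<open>a\<close> and \<open>b\<close> controls the double integral. It serves both the inversion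
  formula and Parseval's formula.\<close>

lemma fourier_multiplication_formula:
  fixes a b :: "real \<Rightarrow> complex"
  assumes a: "integrable lborel a" and b: "integrable lborel b"
  shows "(LINT y|lborel. b y * (LINT v|lborel. a v * cis (y * v))) =
         (LINT v|lborel. a v * (LINT y|lborel. b y * cis (y * v)))"
proof -
  let ?F = "\<lambda>v y. a v * b y * cis (y * v)"
  have [measurable]: "a \<in> borel_measurable borel" "b \<in> borel_measurable borel"
    using a b by (auto dest: borel_measurable_integrable)
  have "integrable (lborel \<Otimes>\<^sub>M lborel) (case_prod ?F)"
  proof (rule lborel_pair.Fubini_integrable)
    show "integrable lborel (\<lambda>v. LINT y|lborel. norm (case_prod ?F (v, y)))"
      using a b by (simp add: norm_mult)
    show "AE v in lborel. integrable lborel (\<lambda>y. case_prod ?F (v, y))"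
      using integrable_mult_cis[OF b] by (simp add: mult.assoc mult.commute[of _ "_ :: real"])
  qed measurable
  then have "(LINT y|lborel. LINT v|lborel. ?F v y) = (LINT v|lborel. LINT y|lborel. ?F v y)"
    by (rule lborel_pair.Fubini_integral)
  moreover have "(LINT v|lborel. ?F v y) = b y * (LINT v|lborel. a v * cis (y * v))" for y
    by (simp add: mult_ac flip: integral_mult_right_zero)
  moreover have "(LINT y|lborel. ?F v y) = a v * (LINT y|lborel. b y * cis (y * v))" for v
    by (simp add: mult_ac flip: integral_mult_right_zero)
  ultimately show ?thesis by simp
qed

text \<open>The left side is the characteristic function of the standard normal law.\<close>

lemma fourier_std_normal_density:
  "(LINT x|lborel. of_real (std_normal_density x) * cis (t * x)) = of_real (exp (- t\<^sup>2 / 2))"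
proof -
  have "char std_normal_distribution t = (LINT x|lborel. std_normal_density x *\<^sub>R cis (t * x))"
    unfolding char_def by (subst integral_density) (auto simp: normal_density_nonneg cis_conv_exp)
  then show ?thesis
    by (simp add: char_std_normal_distribution scaleR_conv_of_real)
qed

text \<open>Insert the Gaussian factor \<open>std_normal_density (\<epsilon> n * y)\<close>. The
  multiplication formula turns the regularised integral into a Gaussian average of \<open>g\<close>
  around \<open>u\<close> of width \<open>\<epsilon> n\<close>. As the width shrinks,
  \<open>G\<close> dominates one side, and the bound \<open>B\<close> times a Gaussian the other;
  continuity at \<open>u\<close> gives the limit.\<close>

lemma fourier_inversion:
  fixes g :: "real \<Rightarrow> complex"
  defines "G \<equiv> \<lambda>y. LINT v|lborel. g v * cis (y * v)"
  assumes g: "integrable lborel g" and cont: "isCont g u" and bd: "\<And>v. norm (g v) \<le> B"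
    and G: "integrable lborel G"
  shows "(LINT y|lborel. G y * cis (- (y * u))) = of_real (2 * pi) * g u"
proof -
  define \<epsilon> where "\<epsilon> = (\<lambda>n. 1 / real (Suc n))"
  have \<epsilon>_pos: "\<epsilon> n > 0" for n by (simp add: \<epsilon>_def)
  have \<epsilon>_lim: "\<epsilon> \<longlonglongrightarrow> 0"
    unfolding \<epsilon>_def by (rule LIMSEQ_Suc[OF lim_1_over_n])
  have [measurable]: "g \<in> borel_measurable borel" "G \<in> borel_measurable borel"
    using g G by (auto dest: borel_measurable_integrable)
  let ?N = "\<lambda>x. complex_of_real (std_normal_density x)"
  have intN: "integrable lborel ?N"
    by (intro integrable_of_real) simp
  have eq: "(LINT y|lborel. G y * cis (- (y * u)) * ?N (\<epsilon> n * y)) =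
        (LINT x|lborel. g (u + \<epsilon> n * x) * of_real (exp (- x\<^sup>2 / 2)))" for n
  proof -
    let ?b = "\<lambda>y. cis (- (y * u)) * ?N (\<epsilon> n * y)"
    have "integrable lborel (\<lambda>y. ?N (0 + \<epsilon> n * y))"
      using \<epsilon>_pos[of n] by (intro lborel_integrable_real_affine[OF intN]) auto
    then have "integrable lborel (\<lambda>y. ?N (\<epsilon> n * y) * cis (- u * y))"
      by (intro integrable_mult_cis) simp
    then have b: "integrable lborel ?b"
      by (simp add: mult_ac)
    \<comment> \<open>The transform of a Gaussian is a Gaussian: the rescaling x = \<epsilon> y
      inverts its width, and the phase \<open>cis (- (y * u))\<close> moves its centre to
      \<open>u\<close>.\<close>
    have inner: "(LINT y|lborel. ?b y * cis (y * v)) = of_real (exp (- ((v - u) / \<epsilon> n)\<^sup>2 / 2) / \<epsilon> n)" for v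
    proof -
      have "of_real (exp (- ((v - u) / \<epsilon> n)\<^sup>2 / 2)) =
            (LINT x|lborel. ?N x * cis ((v - u) / \<epsilon> n * x))"
        by (rule fourier_std_normal_density[symmetric])
      also have "\<dots> = \<epsilon> n *\<^sub>R (LINT y|lborel. ?N (\<epsilon> n * y) * cis ((v - u) / \<epsilon> n * (\<epsilon> n * y)))"
        using \<epsilon>_pos[of n]
          lborel_integral_real_affine[of "\<epsilon> n" "\<lambda>x. ?N x * cis ((v - u) / \<epsilon> n * x)" 0] by simp
      also have "(\<lambda>y. ?N (\<epsilon> n * y) * cis ((v - u) / \<epsilon> n * (\<epsilon> n * y))) = (\<lambda>y. ?b y * cis (y * v))"
      proof
        fix y
        have "(v - u) / \<epsilon> n * (\<epsilon> n * y) = - (y * u) + y * v"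
          using \<epsilon>_pos[of n] by (simp add: field_simps)
        then show "?N (\<epsilon> n * y) * cis ((v - u) / \<epsilon> n * (\<epsilon> n * y)) = ?b y * cis (y * v)"
          by (simp only: cis_mult[symmetric] mult_ac)
      qed
      finally show ?thesis
        using \<epsilon>_pos[of n] by (simp add: scaleR_conv_of_real field_simps)
    qed
    have "(LINT y|lborel. ?b y * G y) = (LINT v|lborel. g v * (LINT y|lborel. ?b y * cis (y * v)))"
      unfolding G_def by (rule fourier_multiplication_formula[OF g b])
    also have "\<dots> = (LINT v|lborel. g v * of_real (exp (- ((v - u) / \<epsilon> n)\<^sup>2 / 2) / \<epsilon> n))"
      unfolding inner ..
    also have "\<dots> = \<epsilon> n *\<^sub>R (LINT x|lborel. g (u + \<epsilon> n * x) * of_real (exp (- x\<^sup>2 / 2) / \<epsilon> n))"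
      using \<epsilon>_pos[of n] by (subst lborel_integral_real_affine[of "\<epsilon> n" _ u]) auto
    also have "\<dots> = (LINT x|lborel. \<epsilon> n *\<^sub>R (g (u + \<epsilon> n * x) * of_real (exp (- x\<^sup>2 / 2) / \<epsilon> n)))"
      by simp
    also have "\<dots> = (LINT x|lborel. g (u + \<epsilon> n * x) * of_real (exp (- x\<^sup>2 / 2)))"
      using \<epsilon>_pos[of n] by (simp add: scaleR_conv_of_real field_simps)
    finally show ?thesis by (simp add: mult_ac)
  qed
  have N_le: "std_normal_density x \<le> 1 / sqrt (2 * pi)" for x
    by (simp add: std_normal_density_def field_simps)
  have "(\<lambda>n. LINT y|lborel. G y * cis (- (y * u)) * ?N (\<epsilon> n * y)) \<longlonglongrightarrow>
        (LINT y|lborel. G y * cis (- (y * u)) * ?N 0)"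
  proof (rule integral_dominated_convergence[where w = "\<lambda>y. norm (G y) * (1 / sqrt (2 * pi))"])
    show "AE y in lborel. (\<lambda>n. G y * cis (- (y * u)) * ?N (\<epsilon> n * y)) \<longlonglongrightarrow> G y * cis (- (y * u)) * ?N 0"
    proof (rule AE_I2)
      fix y
      have "(\<lambda>n. \<epsilon> n * y) \<longlonglongrightarrow> 0" using tendsto_mult_right[OF \<epsilon>_lim, of y] by simp
      moreover have "isCont ?N 0" unfolding std_normal_density_def by (intro continuous_intros) auto
      ultimately have "(\<lambda>n. ?N (\<epsilon> n * y)) \<longlonglongrightarrow> ?N 0"
        by (rule isCont_tendsto_compose[rotated])
      then show "(\<lambda>n. G y * cis (- (y * u)) * ?N (\<epsilon> n * y)) \<longlonglongrightarrow> G y * cis (- (y * u)) * ?N 0"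
        by (rule tendsto_mult_left)
    qed
    show "AE y in lborel. norm (G y * cis (- (y * u)) * ?N (\<epsilon> n * y)) \<le> norm (G y) * (1 / sqrt (2 * pi))" for n
      using mult_left_mono[OF N_le norm_ge_zero] by (intro AE_I2) (simp add: norm_mult)
    show "integrable lborel (\<lambda>y. norm (G y) * (1 / sqrt (2 * pi)))"
      using G by simp
  qed measurable
  moreover have "(\<lambda>n. LINT x|lborel. g (u + \<epsilon> n * x) * of_real (exp (- x\<^sup>2 / 2))) \<longlonglongrightarrow>
        (LINT x|lborel. g u * of_real (exp (- x\<^sup>2 / 2)))"
  proof (rule integral_dominated_convergence[where w = "\<lambda>x. B * (sqrt (2 * pi) * std_normal_density x)"])
    show "AE x in lborel. (\<lambda>n. g (u + \<epsilon> n * x) * of_real (exp (- x\<^sup>2 / 2))) \<longlonglongrightarrow>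
            g u * of_real (exp (- x\<^sup>2 / 2))"
    proof (rule AE_I2)
      fix x
      have "(\<lambda>n. u + \<epsilon> n * x) \<longlonglongrightarrow> u" using tendsto_add[OF tendsto_const tendsto_mult_right[OF \<epsilon>_lim, of x], of u] by simp
      from isCont_tendsto_compose[OF cont this]
      show "(\<lambda>n. g (u + \<epsilon> n * x) * of_real (exp (- x\<^sup>2 / 2))) \<longlonglongrightarrow>
            g u * of_real (exp (- x\<^sup>2 / 2))"
        by (intro tendsto_intros)
    qed
    show "AE x in lborel. norm (g (u + \<epsilon> n * x) * of_real (exp (- x\<^sup>2 / 2))) \<le>
            B * (sqrt (2 * pi) * std_normal_density x)" for n
      using bd by (intro AE_I2) (auto simp: norm_mult std_normal_density_def)
    show "integrable lborel (\<lambda>x. B * (sqrt (2 * pi) * std_normal_density x))"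
      using integrable_normal_density by simp
  qed measurable
  ultimately have "(LINT y|lborel. G y * cis (- (y * u)) * ?N 0) = (LINT x|lborel. g u * of_real (exp (- x\<^sup>2 / 2)))"
    unfolding eq by (rule LIMSEQ_unique)
  moreover have "(LINT x|lborel. g u * of_real (exp (- x\<^sup>2 / 2))) = g u * of_real (sqrt (2 * pi))"
  proof -
    have "(LINT x|lborel. exp (- x\<^sup>2 / 2)) = (LINT x|lborel. sqrt (2 * pi) * std_normal_density x)"
      by (simp add: std_normal_density_def)
    also have "\<dots> = sqrt (2 * pi)"
      by (simp only: integral_mult_right_zero integral_normal_density mult_1_right)
    finally show ?thesis by simp
  qed
  \<comment> \<open>The density at 0 contributes 1 / sqrt(2 \<pi>) on the left, the total Gaussian
    mass sqrt(2 \<pi>) on the right; together they give the factor 2 \<pi>.\<close>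
  ultimately have "(LINT y|lborel. G y * cis (- (y * u))) / of_real (sqrt (2 * pi)) = g u * of_real (sqrt (2 * pi))"
    by (simp add: std_normal_density_def)
  then have "(LINT y|lborel. G y * cis (- (y * u))) = g u * (of_real (sqrt (2 * pi)) * of_real (sqrt (2 * pi)))"
    by (simp add: field_simps)
  also have "complex_of_real (sqrt (2 * pi)) * of_real (sqrt (2 * pi)) = of_real (2 * pi)"
    by (simp flip: of_real_mult)
  finally show ?thesis by (simp add: mult_ac)
qed

section \<open>Parseval's formula for rotated exponentials\<close>

text \<open>\<open>rot_power x \<theta> s\<close> is \<open>(x cis \<theta>)\<^sup>-\<^sup>s\<close>, without the restriction of the principal branch on \<open>\<theta>\<close>.\<close>

definition rot_power :: "real \<Rightarrow> real \<Rightarrow> complex \<Rightarrow> complex" where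
  "rot_power x \<theta> s = of_real x powr (- s) * exp (- (\<i> * of_real \<theta> * s))"

lemma rot_power_eq:
  assumes "x > 0" "\<bar>\<theta>\<bar> < pi"
  shows "rot_power x \<theta> s = (of_real x * cis \<theta>) powr (- s)"
proof -
  have "Ln (cis \<theta>) = \<i> * of_real \<theta>"
    using assms by (simp add: cis_conv_exp Ln_exp)
  then have "cis \<theta> powr (- s) = exp (- (\<i> * of_real \<theta> * s))"
    by (simp add: powr_def mult_ac)
  then show ?thesis
    using powr_times_real_left[of "of_real x" "cis \<theta>" "- s"] assms by (simp add: rot_power_def)
qed

lemma norm_rot_power:
  assumes "x > 0"
  shows "norm (rot_power x \<theta> (Complex c y)) = x powr (- c) * exp (\<theta> * y)"
  using assms by (simp add: rot_power_def norm_mult norm_powr_real_powr)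

lemma continuous_rot_power:
  assumes "x > 0"
  shows "continuous_on UNIV (\<lambda>y. rot_power x \<theta> (Complex c y))"
  unfolding rot_power_def Complex_eq using assms by (intro continuous_intros) auto

lemma continuous_Gamma_vertical:
  fixes a b c :: real
  assumes "c > 0"
  shows "continuous_on UNIV (\<lambda>y. Gamma (Complex c (a * y + b)))"
proof (rule continuous_on_compose2[OF continuous_on_Gamma])
  show "(- \<int>\<^sub>\<le>\<^sub>0) \<inter> (\<int>\<^sub>\<le>\<^sub>0 :: complex set) = {}"
    by auto
  show "continuous_on UNIV (\<lambda>y. Complex c (a * y + b))"
    unfolding Complex_eq by (intro continuous_intros)
  show "range (\<lambda>y. Complex c (a * y + b)) \<subseteq> - \<int>\<^sub>\<le>\<^sub>0"
    using assms by (auto elim!: nonpos_Ints_cases simp: complex_eq_iff)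
qed

text \<open>The power grows at most like exp(|\<theta>| |y|), while Gamma decays at any rate below
  \<pi>/2. The rate \<eta> halfway between |\<theta>| and \<pi>/2 leaves a positive surplus.\<close>

lemma integrable_Gamma_rot_power:
  assumes x: "x > 0" and c: "c > 0" and \<theta>: "\<bar>\<theta>\<bar> < pi / 2"
  shows "integrable lborel (\<lambda>y. Gamma (Complex c y) * rot_power x \<theta> (Complex c y))"
proof -
  define \<eta> where "\<eta> = (\<bar>\<theta>\<bar> + pi / 2) / 2"
  have \<eta>: "0 \<le> \<eta>" "\<eta> < pi / 2" "\<bar>\<theta>\<bar> < \<eta>"
    using \<theta> by (auto simp: \<eta>_def)
  define C where "C = Gamma c * cos \<eta> powr (- c) * x powr (- c)"
  have "integrable lborel (\<lambda>y. C * exp (- (\<eta> - \<bar>\<theta>\<bar>) * \<bar>y\<bar>))"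
    using integrable_exp_neg_abs[of "\<eta> - \<bar>\<theta>\<bar>"] \<eta> by simp
  then show ?thesis
  proof (rule Bochner_Integration.integrable_bound)
    have "continuous_on UNIV (\<lambda>y. Gamma (Complex c y) * rot_power x \<theta> (Complex c y))"
      using continuous_Gamma_vertical[OF c, of 1 0] continuous_rot_power[OF x]
      by (intro continuous_intros) auto
    then show "(\<lambda>y. Gamma (Complex c y) * rot_power x \<theta> (Complex c y)) \<in> borel_measurable lborel"
      by (simp add: borel_measurable_continuous_onI)
    show "AE y in lborel. norm (Gamma (Complex c y) * rot_power x \<theta> (Complex c y))
            \<le> norm (C * exp (- (\<eta> - \<bar>\<theta>\<bar>) * \<bar>y\<bar>))"
    proof (rule AE_I2)
      fix y
      have "norm (Gamma (Complex c y) * rot_power x \<theta> (Complex c y)) \<le>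
         (Gamma c * cos \<eta> powr (- c) * exp (- \<eta> * \<bar>y\<bar>)) * (x powr (- c) * exp (\<theta> * y))"
        using norm_Gamma_vertical_le[of "Complex c y" \<eta>] c \<eta>
        by (simp add: norm_mult norm_rot_power[OF x] mult_right_mono)
      also have "\<dots> = C * exp (- \<eta> * \<bar>y\<bar> + \<theta> * y)"
        by (simp only: C_def exp_add mult_ac)
      also have "\<dots> \<le> C * exp (- (\<eta> - \<bar>\<theta>\<bar>) * \<bar>y\<bar>)"
      proof -
        have "\<theta> * y \<le> \<bar>\<theta>\<bar> * \<bar>y\<bar>"
          by (metis abs_ge_self abs_mult)
        moreover have "C \<ge> 0"
          using c Gamma_real_pos[of c] by (simp add: C_def)
        ultimately show ?thesis
          by (intro mult_left_mono) (auto simp: algebra_simps)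
      qed
      finally show "norm (Gamma (Complex c y) * rot_power x \<theta> (Complex c y))
            \<le> norm (C * exp (- (\<eta> - \<bar>\<theta>\<bar>) * \<bar>y\<bar>))" by simp
    qed
  qed
qed

text \<open>The left side is maximal at v = ln(a / r), and the tangent inequality for exp there
  gives the bound. It bounds t^a exp(-r t) at t = exp v.\<close>

lemma linear_minus_exp_le:
  fixes a r v :: real
  assumes "a > 0" "r > 0"
  shows "a * v - r * exp v \<le> a * (ln (a / r) - 1)"
proof -
  have "1 + (v - ln (a / r)) \<le> exp (v - ln (a / r))"
    by (rule exp_ge_add_one_self)
  also have "\<dots> = exp v * r / a"
    using assms by (simp add: exp_diff)
  finally have "a * (1 + (v - ln (a / r))) \<le> a * (exp v * r / a)"
    using assms by (intro mult_left_mono) auto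
  then show ?thesis
    using assms by (simp add: algebra_simps)
qed

text \<open>At t = exp v this is the integral of exp(-1/t^k) t^(-q) dt/t, the source of the second
  Gamma factor; it follows from Euler's integral by the substitution of -k v for v.\<close>

lemma has_bochner_integral_exp_exp_neg:
  fixes k :: real and q :: complex
  assumes k: "k > 0" and q: "Re q > 0"
  shows "has_bochner_integral lborel (\<lambda>v. of_real (exp (- exp (- (k * v)))) * exp (- (of_real v * q)))
           (Gamma (q / of_real k) / of_real k)"
proof -
  let ?f = "\<lambda>v. of_real (exp (- exp v)) * exp (complex_of_real v * (q / of_real k))"
  have "has_bochner_integral lborel ?f (Gamma (q / of_real k))"
    by (rule has_bochner_integral_exp_exp) (use k q in auto)
  then have "has_bochner_integral lborel (\<lambda>v. ?f (0 + (- k) * v)) (Gamma (q / of_real k) /\<^sub>R \<bar>- k\<bar>)"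
    using k by (subst lborel_has_bochner_integral_real_affine_iff[where c="- k" and t=0, symmetric]) auto
  then show ?thesis
    using k by (simp add: scaleR_conv_of_real divide_inverse mult_ac)
qed

text \<open>Both Gamma factors on the line Re s = c are Fourier transforms in y, of \<open>g\<close>
  and of \<open>A\<close> below. The multiplication formula moves the transform from
  \<open>A\<close> to the first factor, and inversion evaluates the inner integral as 2 \<pi>
  g(-v).\<close>

lemma rotated_Parseval:
  fixes k x c \<theta> :: real and p :: complex
  assumes k: "k > 0" and x: "x > 0" and c: "c > 0" and p: "c + Re p > 1" and \<theta>: "\<bar>\<theta>\<bar> < pi / 2"
  shows "(LINT v|lborel. of_real (exp (- exp (- (k * v)))) * exp (of_real v * (1 - p)) *
                          exp (- (of_real (x * exp v) * cis \<theta>))) =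
         (LINT y|lborel. Gamma (Complex c y) * rot_power x \<theta> (Complex c y) *
             (Gamma ((Complex c y + p - 1) / of_real k) / of_real k)) / of_real (2 * pi)"
proof -
  define w where "w = of_real x * cis \<theta>"
  have w: "Re w > 0"
    using x Re_cis_pos[OF \<theta>] by (simp add: w_def)
  \<comment> \<open>The weight exp(c v) puts the transform on the line Re s = c. \<open>A\<close>
    carries the same weight and is reflected in v, so that the weights cancel in A(-v) g(v) and the
    result is free of c.\<close>
  define g where "g = (\<lambda>v. exp (- w * of_real (exp v)) * exp (complex_of_real (v * c)))"
  define A where "A = (\<lambda>v. of_real (exp (- exp (k * v))) * exp (of_real v * (of_real c + p - 1)))"
  have g_cis: "g v * cis (y * v) = exp (- w * of_real (exp v)) * exp (of_real v * Complex c y)" for v y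
    by (simp add: g_def Complex_eq ring_distribs exp_add cis_conv_exp mult_ac)
  have g_int: "has_bochner_integral lborel (\<lambda>v. g v * cis (y * v))
                (Gamma (Complex c y) * rot_power x \<theta> (Complex c y))" for y
    unfolding g_cis using has_bochner_integral_exp_exp_rotated[of "Complex c y" w] c w rot_power_eq[of x \<theta>] x \<theta>
    by (simp add: w_def)
  have G_eq: "(LINT v|lborel. g v * cis (y * v)) = Gamma (Complex c y) * rot_power x \<theta> (Complex c y)" for y
    using g_int has_bochner_integral_integral_eq by blast
  have g: "integrable lborel g"
    using g_int[of 0] by (simp add: has_bochner_integral_iff)
  have g_bd: "norm (g v) \<le> exp (c * (ln (c / Re w) - 1))" for v
  proof -
    have "norm (g v) = exp (c * v - Re w * exp v)"
      by (simp add: g_def norm_mult mult_ac flip: exp_add)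
    then show ?thesis
      using linear_minus_exp_le[OF c w] by simp
  qed
  have inv: "(LINT y|lborel. Gamma (Complex c y) * rot_power x \<theta> (Complex c y) * cis (y * v))
               = of_real (2 * pi) * g (- v)" for v
    using fourier_inversion[OF g _ g_bd, of "- v"] integrable_Gamma_rot_power[OF x c \<theta>]
    unfolding G_eq by (simp add: g_def)
  have A_cis: "A v * cis (y * v) = of_real (exp (- exp (k * v))) * exp (of_real v * (Complex c y + p - 1))" for v y
    by (simp add: A_def Complex_eq ring_distribs exp_add exp_diff cis_conv_exp mult_ac)
  have A_int: "has_bochner_integral lborel (\<lambda>v. A v * cis (y * v))
                 (Gamma ((Complex c y + p - 1) / of_real k) / of_real k)" for y
  proof -
    let ?f = "\<lambda>v. of_real (exp (- exp (- (k * v)))) * exp (- (of_real v * (Complex c y + p - 1)))"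
    have "has_bochner_integral lborel ?f (Gamma ((Complex c y + p - 1) / of_real k) / of_real k)"
      by (rule has_bochner_integral_exp_exp_neg) (use k p in auto)
    then have "has_bochner_integral lborel (\<lambda>v. ?f (0 + (- 1) * v))
         (Gamma ((Complex c y + p - 1) / of_real k) / of_real k /\<^sub>R \<bar>- 1\<bar>)"
      by (subst lborel_has_bochner_integral_real_affine_iff[where c="- 1" and t=0, symmetric]) auto
    then show ?thesis
      unfolding A_cis by simp
  qed
  have A: "integrable lborel A"
    using A_int[of 0] by (simp add: has_bochner_integral_iff)
  have "(LINT y|lborel. Gamma (Complex c y) * rot_power x \<theta> (Complex c y) * (LINT v|lborel. A v * cis (y * v))) =
        (LINT v|lborel. A v * (LINT y|lborel. Gamma (Complex c y) * rot_power x \<theta> (Complex c y) * cis (y * v)))"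
    by (rule fourier_multiplication_formula[OF A integrable_Gamma_rot_power[OF x c \<theta>]])
  also have "\<dots> = (LINT v|lborel. of_real (2 * pi) * (A v * g (- v)))"
    unfolding inv by (simp add: mult_ac)
  also have "\<dots> = of_real (2 * pi) * (LINT v|lborel. A v * g (- v))"
    by simp
  also have "(LINT v|lborel. A v * g (- v)) = (LINT v|lborel. A (- v) * g v)"
    using lborel_integral_real_affine[of "- 1" "\<lambda>v. A v * g (- v)" 0] by simp
  also have "(\<lambda>v. A (- v) * g v) = (\<lambda>v. of_real (exp (- exp (- (k * v)))) * exp (of_real v * (1 - p)) *
                          exp (- (of_real (x * exp v) * cis \<theta>)))"
  proof
    fix v
    have "exp (of_real (- v) * (of_real c + p - 1)) * exp (complex_of_real (v * c)) = exp (of_real v * (1 - p))"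
      by (simp add: algebra_simps flip: exp_add)
    then show "A (- v) * g v = of_real (exp (- exp (- (k * v)))) * exp (of_real v * (1 - p)) *
                          exp (- (of_real (x * exp v) * cis \<theta>))"
      by (simp add: A_def g_def w_def mult_ac)
  qed
  finally show ?thesis
    unfolding has_bochner_integral_integral_eq[OF A_int] by (simp add: field_simps)
qed

section \<open>Integration by parts\<close>

lemma LINT_derivative_eq_0:
  fixes F f :: "real \<Rightarrow> complex"
  assumes "\<And>v. (F has_vector_derivative f v) (at v)" "\<And>v. isCont f v" "integrable lborel f"
    and "(F \<longlongrightarrow> 0) at_top" "(F \<longlongrightarrow> 0) at_bot"
  shows "(LINT v|lborel. f v) = 0"
proof -
  have "(LBINT x=-\<infinity>..\<infinity>. f x) = 0 - 0"
    using assms by (intro interval_integral_FTC_integrable[where F = F])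
      (auto simp: set_integrable_def ereal_tendsto_simps)
  then show ?thesis
    by (simp add: interval_integral_to_infinity_eq interval_lebesgue_integral_def set_lebesgue_integral_def)
qed

text \<open>\<open>damped_power k p v\<close> is \<open>exp(-1/t\<^sup>k) / t\<^sup>p\<close> at \<open>t = exp v\<close>.\<close>

definition damped_power :: "real \<Rightarrow> complex \<Rightarrow> real \<Rightarrow> complex" where
  "damped_power k p v = of_real (exp (- exp (- (k * v)))) * exp (- (of_real v * p))"

text \<open>Differentiating exp(-exp(-k v)) brings down k exp(-k v), which amounts to raising
  \<open>p\<close> by k. The derivative thus stays in the same family and inherits its
  integrability.\<close>

definition damped_power_deriv :: "real \<Rightarrow> complex \<Rightarrow> real \<Rightarrow> complex" where
  "damped_power_deriv k p v = of_real k * damped_power k (p + of_real k) v - p * damped_power k p v"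

lemma has_vector_derivative_damped_power:
  "(damped_power k p has_vector_derivative damped_power_deriv k p v) (at v)"
proof -
  have "((\<lambda>v. exp (- exp (- (of_real k * v))) * exp (- (v * p))) has_field_derivative
          damped_power_deriv k p v) (at (of_real v))"
    unfolding damped_power_deriv_def damped_power_def
    by (rule derivative_eq_intros refl)+
       (simp add: ring_distribs exp_add exp_diff exp_minus flip: exp_of_real; simp add: field_simps)
  from has_vector_derivative_real_field[OF this] show ?thesis
    by (simp add: damped_power_def[abs_def] exp_of_real flip: exp_of_real)
qed

lemma integrable_damped_power: "k > 0 \<Longrightarrow> Re p > 0 \<Longrightarrow> integrable lborel (damped_power k p)"
  using has_bochner_integral_exp_exp_neg[of k p] by (simp add: damped_power_def[abs_def] has_bochner_integral_iff)

lemma integrable_damped_power_deriv: "k > 0 \<Longrightarrow> Re p > 0 \<Longrightarrow> integrable lborel (damped_power_deriv k p)"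
  unfolding damped_power_deriv_def[abs_def]
  by (intro Bochner_Integration.integrable_diff integrable_mult_right integrable_damped_power) auto

lemma continuous_damped_power: "continuous_on S (damped_power k p)"
  unfolding damped_power_def by (intro continuous_intros)

lemma continuous_damped_power_deriv: "continuous_on S (damped_power_deriv k p)"
  unfolding damped_power_deriv_def by (intro continuous_intros continuous_damped_power)

lemma tendsto_damped_power:
  assumes "k > 0" "Re p > 0"
  shows "(damped_power k p \<longlongrightarrow> 0) at_top" "(damped_power k p \<longlongrightarrow> 0) at_bot"
proof -
  have norm_eq: "norm (damped_power k p v) = exp (- exp (- (k * v))) * exp (- (v * Re p))" for v
    by (simp add: damped_power_def norm_mult)
  define a where "a = Re p"
  have "((\<lambda>v. exp (- exp (- (k * v))) * exp (- (v * a))) \<longlongrightarrow> 0) at_top"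
       "((\<lambda>v. exp (- exp (- (k * v))) * exp (- (v * a))) \<longlongrightarrow> 0) at_bot"
    using assms unfolding a_def[symmetric] by real_asymp+
  then show "(damped_power k p \<longlongrightarrow> 0) at_top" "(damped_power k p \<longlongrightarrow> 0) at_bot"
    by (simp_all only: tendsto_norm_zero_iff[of "damped_power k p", symmetric] norm_eq a_def)
qed

lemma norm_exp_rotated_le:
  assumes "\<bar>\<theta>\<bar> \<le> pi / 2" "r \<ge> 0"
  shows "norm (exp (- (of_real r * cis \<theta>))) \<le> 1"
  using assms cos_ge_zero[of \<theta>] by simp

text \<open>Since exp(v (1 - p)) = exp v exp(-v p), the factor exp v times the rotated exponential
  is a derivative up to the constant -w. Moving it onto \<open>damped_power\<close> leaves an
  integrand dominated by \<open>damped_power_deriv\<close> uniformly in \<theta>, as the limit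
  requires.\<close>

lemma rotated_by_parts:
  fixes k x \<theta> :: real and p :: complex
  assumes k: "k > 0" and x: "x > 0" and p: "Re p > 0" and \<theta>: "\<bar>\<theta>\<bar> < pi / 2"
  shows "(LINT v|lborel. of_real (exp (- exp (- (k * v)))) * exp (of_real v * (1 - p)) *
                          exp (- (of_real (x * exp v) * cis \<theta>))) =
         (LINT v|lborel. damped_power_deriv k p v * exp (- (of_real (x * exp v) * cis \<theta>))) / (of_real x * cis \<theta>)"
proof -
  define w where "w = of_real x * cis \<theta>"
  have w: "Re w > 0"
    using x Re_cis_pos[OF \<theta>] by (simp add: w_def)
  then have w0: "w \<noteq> 0" by auto
  define E where "E = (\<lambda>v. exp (- (w * of_real (exp v))))"
  have E_eq: "exp (- (of_real (x * exp v) * cis \<theta>)) = E v" for v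
    by (simp add: E_def w_def mult_ac)
  have E_le: "norm (E v) \<le> 1" for v
    unfolding E_eq[symmetric] by (rule norm_exp_rotated_le) (use x \<theta> in auto)
  have E_cont: "continuous_on UNIV E" and E_cont': "continuous_on UNIV (\<lambda>v. of_real (exp v) * E v)"
    unfolding E_def by (intro continuous_intros)+
  have E_deriv: "(E has_vector_derivative (- w * (of_real (exp v) * E v))) (at v)" for v
  proof -
    have "((\<lambda>v. exp (- (w * exp v))) has_field_derivative - w * (of_real (exp v) * E v)) (at (of_real v))"
      unfolding E_def by (rule derivative_eq_intros refl)+ (simp add: mult_ac flip: exp_of_real)
    from has_vector_derivative_real_field[OF this] show ?thesis
      by (simp add: E_def exp_of_real)
  qed
  let ?D = "damped_power k p" and ?D' = "damped_power_deriv k p"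
  note dp_meas = borel_measurable_continuous_onI[OF continuous_damped_power]
     borel_measurable_continuous_onI[OF continuous_damped_power_deriv]
  note E_meas = borel_measurable_continuous_onI[OF E_cont] borel_measurable_continuous_onI[OF E_cont']
  have int1: "integrable lborel (\<lambda>v. ?D' v * E v)"
    using integrable_damped_power_deriv[OF k p]
    by (rule Bochner_Integration.integrable_bound)
       (use E_le dp_meas E_meas in \<open>auto simp: norm_mult mult_left_le\<close>)
  have int2: "integrable lborel (\<lambda>v. ?D v * (of_real (exp v) * E v))"
  proof (rule Bochner_Integration.integrable_bound)
    \<comment> \<open>The maximum of exp(v - Re w exp v). It depends on \<theta> through
      \<open>w\<close>, which is harmless while \<theta> is fixed.\<close>
    let ?B = "exp (ln (1 / Re w) - 1)"
    show "integrable lborel (\<lambda>v. ?B * norm (?D v))"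
      using integrable_damped_power[OF k p] by simp
    have "norm (of_real (exp v) * E v) \<le> ?B" for v
    proof -
      have "norm (of_real (exp v) * E v) = exp (1 * v - Re w * exp v)"
        by (simp add: E_def norm_mult flip: exp_add)
      also have "\<dots> \<le> ?B"
        using linear_minus_exp_le[of 1 "Re w" v] w by simp
      finally show ?thesis .
    qed
    then have "norm (?D v) * norm (of_real (exp v) * E v) \<le> norm (?D v) * ?B" for v
      by (intro mult_left_mono) auto
    then show "AE v in lborel. norm (?D v * (of_real (exp v) * E v)) \<le> norm (?B * norm (?D v))"
      by (auto simp: norm_mult mult_ac)
    show "(\<lambda>v. ?D v * (of_real (exp v) * E v)) \<in> borel_measurable lborel"
      using dp_meas E_meas by simp
  qed
  have "(LINT v|lborel. ?D v * (- w * (of_real (exp v) * E v)) + ?D' v * E v) = 0"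
  proof (rule LINT_derivative_eq_0)
    show "((\<lambda>v. ?D v * E v) has_vector_derivative
            ?D v * (- w * (of_real (exp v) * E v)) + ?D' v * E v) (at v)" for v
      by (rule has_vector_derivative_mult[OF has_vector_derivative_damped_power E_deriv])
    have "continuous_on UNIV (\<lambda>v. ?D v * (- w * (of_real (exp v) * E v)) + ?D' v * E v)"
      by (intro continuous_intros continuous_damped_power continuous_damped_power_deriv E_cont)
    then show "isCont (\<lambda>v. ?D v * (- w * (of_real (exp v) * E v)) + ?D' v * E v) v" for v
      by (simp add: continuous_on_eq_continuous_at)
    have "integrable lborel (\<lambda>v. - w * (?D v * (of_real (exp v) * E v)) + ?D' v * E v)"
      using int1 int2 by (intro Bochner_Integration.integrable_add integrable_mult_right)
    then show "integrable lborel (\<lambda>v. ?D v * (- w * (of_real (exp v) * E v)) + ?D' v * E v)"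
      by (simp add: mult_ac)
    have "((\<lambda>v. ?D v * E v) \<longlongrightarrow> 0) F" if "(?D \<longlongrightarrow> 0) F" for F
      using tendsto_norm_zero[OF that]
      by (rule Lim_null_comparison[rotated]) (use E_le in \<open>auto simp: norm_mult mult_left_le\<close>)
    then show "((\<lambda>v. ?D v * E v) \<longlongrightarrow> 0) at_top" "((\<lambda>v. ?D v * E v) \<longlongrightarrow> 0) at_bot"
      using tendsto_damped_power[OF k p] by auto
  qed
  also have "(LINT v|lborel. ?D v * (- w * (of_real (exp v) * E v)) + ?D' v * E v) =
      (LINT v|lborel. - w * (?D v * (of_real (exp v) * E v))) + (LINT v|lborel. ?D' v * E v)"
    using int1 int2 by (subst Bochner_Integration.integral_add[symmetric]) (auto simp: mult_ac)
  finally have "w * (LINT v|lborel. ?D v * (of_real (exp v) * E v)) = (LINT v|lborel. ?D' v * E v)"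
    by simp
  then have "(LINT v|lborel. ?D v * (of_real (exp v) * E v)) = (LINT v|lborel. ?D' v * E v) / w"
    using w0 by (metis nonzero_mult_div_cancel_left)
  moreover have "?D v * (of_real (exp v) * E v) = of_real (exp (- exp (- (k * v)))) * exp (of_real v * (1 - p)) * E v" for v
    by (simp add: damped_power_def ring_distribs exp_diff exp_minus exp_of_real field_simps flip: exp_of_real)
  ultimately show ?thesis
    unfolding E_eq w_def[symmetric] by (simp only:)
qed

section \<open>The limit to the imaginary axis\<close>

text \<open>The integrand on the right of Parseval's formula. With p = k - z, the mean of its values
  at \<theta> = \<pi>/2 and \<theta> = -\<pi>/2 is the integrand of \<open>K_fun\<close>.\<close>

definition mellin_barnes_kernel :: "real \<Rightarrow> complex \<Rightarrow> real \<Rightarrow> real \<Rightarrow> real \<Rightarrow> real \<Rightarrow> complex" where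
  "mellin_barnes_kernel k p x c \<theta> y =
     Gamma (Complex c y) * rot_power x \<theta> (Complex c y) *
       (Gamma ((Complex c y + p - 1) / of_real k) / of_real k)"

lemma borel_measurable_mellin_barnes_kernel:
  assumes "k > 0" "x > 0" "c > 0" "c + Re p > 1"
  shows "mellin_barnes_kernel k p x c \<theta> \<in> borel_measurable borel"
proof -
  have "(Complex c y + p - 1) / of_real k = Complex ((c + Re p - 1) / k) (1 / k * y + Im p / k)" for y
    using assms by (simp add: complex_eq_iff Re_divide_of_real Im_divide_of_real add_divide_distrib)
  then have "continuous_on UNIV (\<lambda>y. Gamma ((Complex c y + p - 1) / of_real k))"
    using continuous_Gamma_vertical[of "(c + Re p - 1) / k" "1 / k" "Im p / k"] assms by simp
  then show ?thesis
    unfolding mellin_barnes_kernel_def using assms continuous_Gamma_vertical[of c 1 0]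
    by (intro borel_measurable_continuous_onI continuous_intros continuous_rot_power) auto
qed

text \<open>The second Gamma factor compensates the loss of exponential decay of the first one as \<open>\<theta>\<close> tends to \<open>\<plusminus>\<pi>/2\<close>,
  so that the bound is uniform up to these limits.\<close>

lemma norm_mellin_barnes_kernel_le:
  fixes k x c :: real and p :: complex
  assumes k: "k \<ge> 1" and x: "x > 0" and c: "c > 0" and p: "c + Re p > 1"
  obtains C where "\<And>\<theta> y. \<bar>\<theta>\<bar> \<le> pi / 2 \<Longrightarrow>
     norm (mellin_barnes_kernel k p x c \<theta> y) \<le> C * exp (- (1 / (2 * k)) * \<bar>y\<bar>)"
proof
  \<comment> \<open>The rotation costs at most the rate \<pi>/2, of which the first Gamma factor
    regains all but 1/(2k). The second, rotated by the angle 1 < \<pi>/2, decays at rate 1/k because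
    its argument is divided by k. The net rate is 1/(2k).\<close>
  define \<eta> where "\<eta> = pi / 2 - 1 / (2 * k)"
  have pi: "pi / 2 > 1" using pi_gt3 by simp
  have "1 / (2 * k) \<le> 1" "1 / (2 * k) > 0"
    using k by auto
  with pi have "1 / (2 * k) < pi / 2" "1 / (2 * k) > 0"
    by linarith+
  then have \<eta>: "0 \<le> \<eta>" "\<eta> < pi / 2" by (auto simp: \<eta>_def)
  define d where "d = (c + Re p - 1) / k"
  have d: "d > 0" using k p by (simp add: d_def)
  define C1 where "C1 = Gamma c * cos \<eta> powr (- c)"
  define C2 where "C2 = Gamma d * cos 1 powr (- d) * exp (\<bar>Im p\<bar> / k)"
  have C: "C1 \<ge> 0" "C2 \<ge> 0"
    using Gamma_real_pos[OF c] Gamma_real_pos[OF d] by (simp_all add: C1_def C2_def)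
  fix \<theta> y :: real assume \<theta>: "\<bar>\<theta>\<bar> \<le> pi / 2"
  have 1: "norm (Gamma (Complex c y)) \<le> C1 * exp (- \<eta> * \<bar>y\<bar>)"
    using norm_Gamma_vertical_le[of "Complex c y" \<eta>] c \<eta> by (simp add: C1_def)
  have "norm (Gamma ((Complex c y + p - 1) / of_real k)) \<le> Gamma d * cos 1 powr (- d) * exp (- \<bar>(y + Im p) / k\<bar>)"
    using norm_Gamma_vertical_le[of "(Complex c y + p - 1) / of_real k" 1] d pi
    by (simp add: d_def Re_divide_of_real Im_divide_of_real)
  also have "\<dots> \<le> Gamma d * cos 1 powr (- d) * exp (\<bar>Im p\<bar> / k - \<bar>y\<bar> / k)"
  proof -
    have "\<bar>y\<bar> - \<bar>Im p\<bar> \<le> \<bar>y + Im p\<bar>" by simp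
    then have "\<bar>y\<bar> / k - \<bar>Im p\<bar> / k \<le> \<bar>(y + Im p) / k\<bar>"
      using k by (simp add: abs_divide divide_right_mono flip: diff_divide_distrib)
    then show ?thesis
      using Gamma_real_pos[OF d] by (intro mult_left_mono) auto
  qed
  also have "\<dots> = C2 * exp (- (\<bar>y\<bar> / k))"
    by (simp add: C2_def exp_diff exp_minus divide_inverse)
  finally have "norm (Gamma ((Complex c y + p - 1) / of_real k)) / k \<le> C2 * exp (- (\<bar>y\<bar> / k)) / 1"
    using k C by (intro frac_le) auto
  then have 2: "norm (Gamma ((Complex c y + p - 1) / of_real k) / of_real k) \<le> C2 * exp (- (\<bar>y\<bar> / k))"
    using k by (simp add: norm_divide)
  have "\<theta> * y \<le> \<bar>\<theta>\<bar> * \<bar>y\<bar>"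
    by (metis abs_ge_self abs_mult)
  also have "\<dots> \<le> pi / 2 * \<bar>y\<bar>"
    using \<theta> by (intro mult_right_mono) auto
  finally have 3: "norm (rot_power x \<theta> (Complex c y)) \<le> x powr (- c) * exp (pi / 2 * \<bar>y\<bar>)"
    using x by (simp add: norm_rot_power mult_left_mono)
  have "norm (mellin_barnes_kernel k p x c \<theta> y) \<le>
     C1 * exp (- \<eta> * \<bar>y\<bar>) * (x powr (- c) * exp (pi / 2 * \<bar>y\<bar>)) * (C2 * exp (- (\<bar>y\<bar> / k)))"
    unfolding mellin_barnes_kernel_def norm_mult using C by (intro mult_mono 1 2 3) auto
  also have "\<dots> = C1 * x powr (- c) * C2 * (exp (- \<eta> * \<bar>y\<bar>) * exp (pi / 2 * \<bar>y\<bar>) * exp (- (\<bar>y\<bar> / k)))"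
    by (simp only: mult_ac)
  also have "exp (- \<eta> * \<bar>y\<bar>) * exp (pi / 2 * \<bar>y\<bar>) * exp (- (\<bar>y\<bar> / k)) = exp (- (1 / (2 * k)) * \<bar>y\<bar>)"
    unfolding exp_add[symmetric] using k by (simp add: \<eta>_def field_simps)
  finally show "norm (mellin_barnes_kernel k p x c \<theta> y) \<le> C1 * x powr (- c) * C2 * exp (- (1 / (2 * k)) * \<bar>y\<bar>)" .
qed

lemma integrable_mellin_barnes_kernel:
  assumes "k \<ge> 1" "x > 0" "c > 0" "c + Re p > 1" "\<bar>\<theta>\<bar> \<le> pi / 2"
  shows "integrable lborel (mellin_barnes_kernel k p x c \<theta>)"
proof -
  obtain C where C: "\<And>\<theta> y. \<bar>\<theta>\<bar> \<le> pi / 2 \<Longrightarrow>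
     norm (mellin_barnes_kernel k p x c \<theta> y) \<le> C * exp (- (1 / (2 * k)) * \<bar>y\<bar>)"
    using norm_mellin_barnes_kernel_le[OF assms(1-4)] by blast
  have "integrable lborel (\<lambda>y. C * exp (- (1 / (2 * k)) * \<bar>y\<bar>))"
    using assms by (intro integrable_mult_right integrable_exp_neg_abs) auto
  then show ?thesis
    by (rule Bochner_Integration.integrable_bound)
       (use assms C borel_measurable_mellin_barnes_kernel[of k x c p \<theta>] in \<open>auto intro: order_trans[OF _ abs_ge_self]\<close>)
qed

lemma rotated_Parseval_limit:
  fixes k x c \<theta> :: real and p :: complex
  assumes k: "k \<ge> 1" and x: "x > 0" and c: "c > 0" and p: "Re p > 0" "c + Re p > 1" and \<theta>: "\<bar>\<theta>\<bar> \<le> pi / 2"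
  shows "(LINT v|lborel. damped_power_deriv k p v * exp (- (of_real (x * exp v) * cis \<theta>))) / (of_real x * cis \<theta>) =
         (LINT y|lborel. mellin_barnes_kernel k p x c \<theta> y) / of_real (2 * pi)"
proof -
  \<comment> \<open>Shrinking \<theta> towards 0 by a factor below 1 stays strictly inside the range
    of the absolutely convergent formulas, even when |\<theta>| = \<pi>/2.\<close>
  define \<psi> where "\<psi> = (\<lambda>n. \<theta> * (1 - 1 / real (Suc n)))"
  have \<psi>_less: "\<bar>\<psi> n\<bar> < pi / 2" for n
  proof -
    have "\<bar>\<psi> n\<bar> = \<bar>\<theta>\<bar> * (1 - 1 / real (Suc n))"
      by (simp add: \<psi>_def abs_mult)
    also have "\<dots> \<le> pi / 2 * (1 - 1 / real (Suc n))"
      using \<theta> by (intro mult_right_mono) auto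
    also have "\<dots> < pi / 2 * 1"
      by (intro mult_strict_left_mono) auto
    finally show ?thesis by simp
  qed
  have "(\<lambda>n. 1 / real (Suc n)) \<longlonglongrightarrow> 0"
    by (rule LIMSEQ_Suc[OF lim_1_over_n])
  then have "\<psi> \<longlonglongrightarrow> \<theta> * (1 - 0)"
    unfolding \<psi>_def by (intro tendsto_intros)
  then have \<psi>_lim: "\<psi> \<longlonglongrightarrow> \<theta>" by simp
  let ?L = "\<lambda>\<theta>. LINT v|lborel. damped_power_deriv k p v * exp (- (of_real (x * exp v) * cis \<theta>))"
  let ?R = "\<lambda>\<theta>. LINT y|lborel. mellin_barnes_kernel k p x c \<theta> y"
  have k0: "k > 0" using k by simp
  have eq: "?L (\<psi> n) / (of_real x * cis (\<psi> n)) = ?R (\<psi> n) / of_real (2 * pi)" for n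
    using rotated_Parseval[OF k0 x c p(2) \<psi>_less[of n]] rotated_by_parts[OF k0 x p(1) \<psi>_less[of n]]
    by (simp add: mellin_barnes_kernel_def)
  have "(\<lambda>n. ?L (\<psi> n)) \<longlonglongrightarrow> ?L \<theta>"
  proof (rule integral_dominated_convergence[where w = "\<lambda>v. norm (damped_power_deriv k p v)"])
    have meas: "(\<lambda>v. damped_power_deriv k p v * exp (- (of_real (x * exp v) * cis \<theta>))) \<in> borel_measurable lborel" for \<theta>
      by (simp, intro borel_measurable_continuous_onI continuous_intros continuous_damped_power_deriv)
    show "(\<lambda>v. damped_power_deriv k p v * exp (- (of_real (x * exp v) * cis \<theta>))) \<in> borel_measurable lborel"
         "(\<lambda>v. damped_power_deriv k p v * exp (- (of_real (x * exp v) * cis (\<psi> n)))) \<in> borel_measurable lborel" for n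
      by (rule meas)+
    show "integrable lborel (\<lambda>v. norm (damped_power_deriv k p v))"
      using integrable_damped_power_deriv[OF k0 p(1)] by simp
    have "(\<lambda>n. cis (\<psi> n)) \<longlonglongrightarrow> cis \<theta>"
      using \<psi>_lim by (intro tendsto_intros)
    then show "AE v in lborel. (\<lambda>n. damped_power_deriv k p v * exp (- (of_real (x * exp v) * cis (\<psi> n))))
           \<longlonglongrightarrow> damped_power_deriv k p v * exp (- (of_real (x * exp v) * cis \<theta>))"
      by (intro AE_I2 tendsto_mult tendsto_exp tendsto_minus tendsto_const)
    show "AE v in lborel. norm (damped_power_deriv k p v * exp (- (of_real (x * exp v) * cis (\<psi> n))))
            \<le> norm (damped_power_deriv k p v)" for n
    proof (rule AE_I2)
      fix v
      have "norm (exp (- (of_real (x * exp v) * cis (\<psi> n)))) \<le> 1"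
        using \<psi>_less[of n] x by (intro norm_exp_rotated_le) auto
      then show "norm (damped_power_deriv k p v * exp (- (of_real (x * exp v) * cis (\<psi> n))))
            \<le> norm (damped_power_deriv k p v)"
        unfolding norm_mult by (intro mult_left_le) auto
    qed
  qed
  then have "(\<lambda>n. ?L (\<psi> n) / (of_real x * cis (\<psi> n))) \<longlonglongrightarrow> ?L \<theta> / (of_real x * cis \<theta>)"
    using x \<psi>_lim by (intro tendsto_intros) auto
  moreover have "(\<lambda>n. ?R (\<psi> n)) \<longlonglongrightarrow> ?R \<theta>"
  proof -
    obtain C where C: "\<And>\<theta> y. \<bar>\<theta>\<bar> \<le> pi / 2 \<Longrightarrow>
       norm (mellin_barnes_kernel k p x c \<theta> y) \<le> C * exp (- (1 / (2 * k)) * \<bar>y\<bar>)"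
      using norm_mellin_barnes_kernel_le[OF k x c p(2)] by blast
    show ?thesis
    proof (rule integral_dominated_convergence[where w = "\<lambda>y. C * exp (- (1 / (2 * k)) * \<bar>y\<bar>)"])
      show "integrable lborel (\<lambda>y. C * exp (- (1 / (2 * k)) * \<bar>y\<bar>))"
        using k by (intro integrable_mult_right integrable_exp_neg_abs) auto
      show "AE y in lborel. norm (mellin_barnes_kernel k p x c (\<psi> n) y) \<le> C * exp (- (1 / (2 * k)) * \<bar>y\<bar>)" for n
        using C[OF less_imp_le[OF \<psi>_less]] by simp
      show "AE y in lborel. (\<lambda>n. mellin_barnes_kernel k p x c (\<psi> n) y) \<longlonglongrightarrow> mellin_barnes_kernel k p x c \<theta> y"
        unfolding mellin_barnes_kernel_def rot_power_def using \<psi>_lim k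
        by (intro AE_I2 tendsto_intros) auto
    qed (use borel_measurable_mellin_barnes_kernel[OF k0 x c p(2)] in auto)
  qed
  then have "(\<lambda>n. ?R (\<psi> n) / of_real (2 * pi)) \<longlonglongrightarrow> ?R \<theta> / of_real (2 * pi)"
    by (intro tendsto_intros) auto
  ultimately show ?thesis
    unfolding eq by (rule LIMSEQ_unique)
qed

section \<open>The conditionally convergent integral over the half-line\<close>

text \<open>The gauge integral over an unbounded set is a limit over growing boxes, so the limits of
  the antiderivative at both ends determine it. This covers integrals that converge only
  conditionally.\<close>

lemma has_integral_derivative_Ioi:
  fixes F f :: "real \<Rightarrow> complex"
  assumes deriv: "\<And>t. t > 0 \<Longrightarrow> (F has_vector_derivative f t) (at t)"
    and at_0: "(F \<longlongrightarrow> 0) (at_right 0)" and at_top: "(F \<longlongrightarrow> L) at_top"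
  shows "(f has_integral L) {0<..}"
proof -
  \<comment> \<open>The value of \<open>F\<close> at 0 is arbitrary; replacing it by the limit 0
    gives an antiderivative continuous on the closed half-line.\<close>
  define F0 where "F0 = (\<lambda>t. if t \<le> 0 then 0 else F t)"
  have F0_deriv: "(F0 has_vector_derivative f t) (at t)" if "t > 0" for t
    by (rule has_vector_derivative_transform_within_open[OF deriv[OF that], of "{0<..}"])
       (use that in \<open>auto simp: F0_def\<close>)
  have "continuous_on {0..} F0"
  proof (rule continuous_on_eq_continuous_within[THEN iffD2], safe)
    fix t :: real assume "t \<ge> 0"
    show "continuous (at t within {0..}) F0"
    proof (cases "t = 0")
      case True
      have "(F0 \<longlongrightarrow> 0) (at_right 0)"
        using at_0 by (rule Lim_transform_eventually) (auto simp: F0_def eventually_at_filter)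
      then have "(F0 \<longlongrightarrow> F0 0) (at 0 within {0..})"
        by (simp add: F0_def at_within_Ici_at_right)
      then show ?thesis
        using True by (simp add: continuous_within)
    next
      case False
      then have "isCont F0 t"
        using F0_deriv[of t] \<open>t \<ge> 0\<close> has_vector_derivative_continuous by auto
      then show ?thesis
        by (rule continuous_at_imp_continuous_within)
    qed
  qed
  then have F0_cont: "continuous_on {0..b} F0" for b
    by (rule continuous_on_subset) auto
  have FTC: "(f has_integral F b) {0..b}" if "b > 0" for b
  proof -
    have "(f has_integral F0 b - F0 0) {0..b}"
      using that F0_cont F0_deriv by (intro fundamental_theorem_of_calculus_interior) auto
    then show ?thesis
      using that by (simp add: F0_def)
  qed
  show ?thesis
  proof (subst has_integral', intro allI impI)
    fix e :: real assume "e > 0"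
    then obtain N where N: "\<And>b. b \<ge> N \<Longrightarrow> norm (F b - L) < e"
      using at_top by (auto simp: tendsto_iff dist_norm eventually_at_top_linorder)
    \<comment> \<open>A box containing this ball has right end b with b > 0, for the fundamental
      theorem, and b \<ge> N, for the closeness to \<open>L\<close>.\<close>
    define B where "B = max 1 N"
    show "\<exists>B>0. \<forall>a b. ball 0 B \<subseteq> cbox a b \<longrightarrow>
      (\<exists>z. ((\<lambda>t. if t \<in> {0<..} then f t else 0) has_integral z) (cbox a b) \<and> norm (z - L) < e)"
    proof (intro exI[of _ B] conjI allI impI)
      show "B > 0" by (simp add: B_def)
      fix a b :: real assume sub: "ball 0 B \<subseteq> cbox a b"
      have *: "a \<le> y \<and> y \<le> b" if "\<bar>y\<bar> < B" for y
        using sub that by (auto simp: subset_iff)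
      have "b \<ge> B"
      proof (rule dense_le)
        fix y assume "y < B"
        then show "y \<le> b" using *[of "max 0 y"] \<open>B > 0\<close> by auto
      qed
      moreover have "a \<le> 0" using *[of 0] \<open>B > 0\<close> by simp
      ultimately have b: "b > 0" "b \<ge> N" and sub': "{0..b} \<subseteq> cbox a b"
        by (auto simp: B_def)
      have "((\<lambda>t. if t \<in> {0..b} then f t else 0) has_integral F b) (cbox a b)"
        using FTC[OF b(1)] sub' by (simp only: has_integral_restrict)
      then have "((\<lambda>t. if t \<in> {0<..} then f t else 0) has_integral F b) (cbox a b)"
        by (rule has_integral_spike[OF negligible_sing[of 0], rotated]) auto
      then show "\<exists>z. ((\<lambda>t. if t \<in> {0<..} then f t else 0) has_integral z) (cbox a b) \<and> norm (z - L) < e"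
        using N[OF b(2)] by blast
    qed
  qed
qed

text \<open>Integration by parts on the half-line: the derivative of \<open>?D t * H t\<close> has
  integral 0, and its part \<open>?D' t * H t\<close> is absolutely integrable with an integral
  known from the limiting Parseval formula. The difference of the two is the oscillating
  integral.\<close>

lemma has_integral_damped_oscillation:
  fixes k x c \<theta> :: real and p :: complex
  assumes k: "k \<ge> 1" and x: "x > 0" and c: "c > 0" and p: "Re p > 0" "c + Re p > 1" and \<theta>: "\<bar>\<theta>\<bar> \<le> pi / 2"
  shows "((\<lambda>t. damped_power k p (ln t) * exp (- (of_real (x * t) * cis \<theta>))) has_integral
         (LINT y|lborel. mellin_barnes_kernel k p x c \<theta> y) / of_real (2 * pi)) {0<..}"
proof -
  define w where "w = of_real x * cis \<theta>"
  have w0: "w \<noteq> 0" using x by (simp add: w_def)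
  have k0: "k > 0" using k by simp
  \<comment> \<open>An antiderivative of exp(-w t), bounded for t \<ge> 0 even at |\<theta>| =
    \<pi>/2, where it does not decay. The boundary terms vanish because \<open>damped_power\<close>
    does at both ends.\<close>
  define H where "H = (\<lambda>t. - exp (- (w * of_real t)) / w)"
  have E_eq: "exp (- (of_real (x * t) * cis \<theta>)) = exp (- (w * of_real t))" for t
    by (simp add: w_def mult_ac)
  have E_le: "norm (exp (- (w * of_real t))) \<le> 1" if "t \<ge> 0" for t
    unfolding E_eq[symmetric] by (rule norm_exp_rotated_le) (use x \<theta> that in auto)
  have H_deriv: "(H has_vector_derivative exp (- (w * of_real t))) (at t)" for t
  proof -
    have "((\<lambda>t. - exp (- (w * t)) / w) has_field_derivative exp (- (w * of_real t))) (at (of_real t))"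
      using w0 by (auto intro!: derivative_eq_intros)
    from has_vector_derivative_real_field[OF this] show ?thesis
      by (simp add: H_def)
  qed
  let ?D = "\<lambda>t. damped_power k p (ln t)" and ?D' = "\<lambda>t. inverse t *\<^sub>R damped_power_deriv k p (ln t)"
  have D_deriv: "(?D has_vector_derivative ?D' t) (at t)" if "t > 0" for t
  proof -
    have "(ln has_vector_derivative inverse t) (at t)"
      using that by (auto intro!: derivative_eq_intros simp: has_real_derivative_iff_has_vector_derivative[symmetric] divide_inverse)
    from vector_diff_chain_at[OF this has_vector_derivative_damped_power] show ?thesis
      by (simp add: o_def)
  qed
  have "((\<lambda>t. ?D t * exp (- (w * of_real t)) + ?D' t * H t) has_integral 0) {0<..}"
  proof (rule has_integral_derivative_Ioi[where F = "\<lambda>t. ?D t * H t"])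
    show "((\<lambda>t. ?D t * H t) has_vector_derivative ?D t * exp (- (w * of_real t)) + ?D' t * H t) (at t)"
      if "t > 0" for t
      by (rule has_vector_derivative_mult[OF D_deriv[OF that] H_deriv])
    have H_le: "norm (H t) \<le> 1 / norm w" if "t \<ge> 0" for t
      using E_le[OF that] by (simp add: H_def norm_divide divide_right_mono)
    have lim: "((\<lambda>t. ?D t * H t) \<longlongrightarrow> 0) F" if "(?D \<longlongrightarrow> 0) F" "\<forall>\<^sub>F t in F. t \<ge> 0" for F
    proof (rule Lim_null_comparison)
      show "\<forall>\<^sub>F t in F. norm (?D t * H t) \<le> norm (?D t) * (1 / norm w)"
        using that(2) by eventually_elim (simp only: norm_mult H_le mult_left_mono norm_ge_zero)
      show "((\<lambda>t. norm (?D t) * (1 / norm w)) \<longlongrightarrow> 0) F"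
        using tendsto_mult_left_zero[OF tendsto_norm_zero[OF that(1)]] .
    qed
    show "((\<lambda>t. ?D t * H t) \<longlongrightarrow> 0) (at_right 0)"
      by (rule lim[OF filterlim_compose[OF tendsto_damped_power(2)[OF k0 p(1)] ln_at_0]])
         (auto simp: eventually_at_filter)
    show "((\<lambda>t. ?D t * H t) \<longlongrightarrow> 0) at_top"
      by (rule lim[OF filterlim_compose[OF tendsto_damped_power(1)[OF k0 p(1)] ln_at_top]])
         (rule eventually_ge_at_top)
  qed
  moreover have "((\<lambda>t. ?D' t * H t) has_integral
      - (LINT v|lborel. damped_power_deriv k p v * exp (- (of_real (x * exp v) * cis \<theta>))) / w) {0<..}"
  proof -
    let ?I = "LINT v|lborel. damped_power_deriv k p v * exp (- (of_real (x * exp v) * cis \<theta>))"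
    let ?h = "\<lambda>v. damped_power_deriv k p v * exp (- (of_real (x * exp v) * cis \<theta>))"
    have h: "integrable lborel ?h"
      using integrable_damped_power_deriv[OF k0 p(1)]
    proof (rule Bochner_Integration.integrable_bound)
      show "?h \<in> borel_measurable lborel"
        by (simp, intro borel_measurable_continuous_onI continuous_intros continuous_damped_power_deriv)
      show "AE v in lborel. norm (?h v) \<le> norm (damped_power_deriv k p v)"
        unfolding norm_mult using x \<theta> by (intro AE_I2 mult_left_le norm_exp_rotated_le) auto
    qed
    then have "has_bochner_integral lborel (\<lambda>v. ?h v * (- inverse w)) (?I * (- inverse w))"
      by (intro has_bochner_integral_mult_left) (auto simp: has_bochner_integral_iff)
    \<comment> \<open>The Jacobian exp v of the substitution cancels the factor 1/t from the chain
      rule.\<close>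
    moreover have "?h v * (- inverse w) = exp v *\<^sub>R (?D' (exp v) * H (exp v))" for v
      unfolding E_eq by (simp add: H_def divide_inverse)
    ultimately have "has_bochner_integral lborel (\<lambda>v. exp v *\<^sub>R (?D' (exp v) * H (exp v))) (- ?I / w)"
      by (simp only:) (simp add: divide_inverse)
    then have int: "integrable lborel (\<lambda>v. exp v *\<^sub>R (?D' (exp v) * H (exp v)))"
      and eq: "(LINT v|lborel. exp v *\<^sub>R (?D' (exp v) * H (exp v))) = - ?I / w"
      by (auto simp only: has_bochner_integral_iff)
    have "(\<lambda>v. exp v *\<^sub>R (?D' (exp v) * H (exp v))) absolutely_integrable_on UNIV"
      using int borel_measurable_integrable[OF int] by (simp add: set_integrable_def integrable_completion)
    moreover have "integral UNIV (\<lambda>v. exp v *\<^sub>R (?D' (exp v) * H (exp v))) = - ?I / w"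
      using integral_lborel[OF int] eq by simp
    ultimately have "(\<lambda>t. ?D' t * H t) absolutely_integrable_on {0<..} \<and> integral {0<..} (\<lambda>t. ?D' t * H t) = - ?I / w"
      by (intro exp_substitution[THEN iffD1]) simp
    then show ?thesis
      using absolutely_integrable_on_def integrable_integral by metis
  qed
  ultimately have "((\<lambda>t. (?D t * exp (- (w * of_real t)) + ?D' t * H t) - ?D' t * H t) has_integral
     0 - (- (LINT v|lborel. damped_power_deriv k p v * exp (- (of_real (x * exp v) * cis \<theta>))) / w)) {0<..}"
    by (rule has_integral_diff)
  then show ?thesis
    unfolding E_eq using rotated_Parseval_limit[OF k x c p \<theta>] by (simp add: w_def mult_ac)
qed

section \<open>The cosine as the mean of the two quarter turns\<close>

theorem theorem4p4:
  fixes k :: nat and z :: complex and x c :: real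
  assumes "k \<ge> 1"
    and "Re z < real k"
    and "x > 0"
    and "c > max 0 (1 - real k + Re z)"
  shows "((\<lambda>t::real. of_real (exp (- (1 / t ^ k)) * cos (x * t)) / of_real t powr (of_nat k - z))
           has_integral K_fun c k z x) {0<..}"
proof -
  \<comment> \<open>The exponent of t in the integrand. It turns (s - 1 - z)/k + 1 into (s + p -
    1)/k and the lower bounds on \<open>c\<close> into c > 0 and c + Re p > 1.\<close>
  define p where "p = of_nat k - z"
  have p: "Re p > 0" "c + Re p > 1" and c: "c > 0" and k: "real k \<ge> 1"
    using assms by (auto simp: p_def)
  let ?M = "mellin_barnes_kernel (real k) p x c"
  let ?E = "\<lambda>\<theta> t. damped_power (real k) p (ln t) * exp (- (of_real (x * t) * cis \<theta>))"
  have main: "((\<lambda>t. (?E (pi / 2) t + ?E (- pi / 2) t) * (1 / 2)) has_integral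
     ((LINT y|lborel. ?M (pi / 2) y) / of_real (2 * pi) + (LINT y|lborel. ?M (- pi / 2) y) / of_real (2 * pi)) * (1 / 2)) {0<..}"
    by (intro has_integral_mult_left has_integral_add has_integral_damped_oscillation k assms(3) c p) auto
  have val: "((LINT y|lborel. ?M (pi / 2) y) / of_real (2 * pi) + (LINT y|lborel. ?M (- pi / 2) y) / of_real (2 * pi)) * (1 / 2)
       = K_fun c k z x"
  proof -
    have M: "Gamma s * cos (of_real pi * s / 2) * Gamma ((s - 1 - z) / of_nat k + 1) / (of_nat k * of_real x powr s) * \<i>
        = (?M (pi / 2) y + ?M (- pi / 2) y) * (\<i> / 2)" if "s = Complex c y" for s y
    proof -
      have "(s - 1 - z) / of_nat k + 1 = (s + p - 1) / of_nat k"
        using k by (simp add: p_def field_simps)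
      moreover have "cos (of_real pi * s / 2) = (exp (\<i> * (of_real pi * s / 2)) + exp (- (\<i> * (of_real pi * s / 2)))) / 2"
        by (rule cos_exp_eq)
      moreover have "rot_power x (pi / 2) s = exp (- (\<i> * (of_real pi * s / 2))) / of_real x powr s"
        "rot_power x (- pi / 2) s = exp (\<i> * (of_real pi * s / 2)) / of_real x powr s"
      proof -
        have "- (\<i> * of_real (pi / 2) * s) = - (\<i> * (of_real pi * s / 2))"
          "- (\<i> * of_real (- pi / 2) * s) = \<i> * (of_real pi * s / 2)"
          by simp_all
        then show "rot_power x (pi / 2) s = exp (- (\<i> * (of_real pi * s / 2))) / of_real x powr s"
          "rot_power x (- pi / 2) s = exp (\<i> * (of_real pi * s / 2)) / of_real x powr s"
          by (simp_all only: rot_power_def powr_minus divide_inverse mult.commute)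
      qed
      \<comment> \<open>The angle \<pi>/2 belongs to exp(-\<i> \<pi> s/2), the second summand of the
        cosine, which is why \<open>e1\<close> and \<open>e2\<close> change places.\<close>
      moreover have "a * ((e1 + e2) / 2) * b / (n * q) * \<i> =
          (a * (e2 / q) * (b / n) + a * (e1 / q) * (b / n)) * (\<i> / 2)" for a b e1 e2 n q :: complex
      proof -
        have "a * ((e1 + e2) / 2) * b / (n * q) * \<i> = (e2 + e1) * (a * b / (n * q) * (\<i> / 2))"
          by (simp only: times_divide_eq_left times_divide_eq_right mult_ac add_ac divide_divide_eq_left)
        also have "\<dots> = (a * (e2 / q) * (b / n) + a * (e1 / q) * (b / n)) * (\<i> / 2)"
          unfolding distrib_right
          by (simp only: times_divide_eq_left times_divide_eq_right mult_ac divide_divide_eq_left)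
        finally show ?thesis .
      qed
      ultimately show ?thesis
        unfolding mellin_barnes_kernel_def that[symmetric] of_real_of_nat_eq by (simp only:)
    qed
    have "vertical_line_integral c (\<lambda>s. Gamma s * cos (of_real pi * s / 2) * Gamma ((s - 1 - z) / of_nat k + 1)
            / (of_nat k * of_real x powr s)) = (LINT y|lborel. (?M (pi / 2) y + ?M (- pi / 2) y) * (\<i> / 2))"
      unfolding vertical_line_integral_def by (intro Bochner_Integration.integral_cong refl M)
    also have "\<dots> = ((LINT y|lborel. ?M (pi / 2) y) + (LINT y|lborel. ?M (- pi / 2) y)) * (\<i> / 2)"
      unfolding integral_mult_left_zero
      by (subst Bochner_Integration.integral_add)
         (auto intro!: integrable_mellin_barnes_kernel k assms(3) c p)
    \<comment> \<open>The factor \<i> of ds cancels against the prefactor 1/(2 \<pi> \<i>), leaving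
      the 1/(2 \<pi>) of Parseval's formula.\<close>
    finally show ?thesis
      unfolding K_fun_def by (simp only:) (simp add: field_simps)
  qed
  have integrand: "(?E (pi / 2) t + ?E (- pi / 2) t) * (1 / 2) =
      of_real (exp (- (1 / t ^ k)) * cos (x * t)) / of_real t powr (of_nat k - z)" if "t \<in> {0<..}" for t
  proof -
    have "exp (real k * ln t) = t ^ k"
      using that by (simp add: exp_of_nat_mult)
    then have "exp (- (real k * ln t)) = 1 / t ^ k"
      by (simp add: exp_minus inverse_eq_divide)
    then have D: "damped_power (real k) p (ln t) = of_real (exp (- (1 / t ^ k))) / of_real t powr p"
      using that by (simp add: damped_power_def powr_def Ln_of_real exp_minus divide_inverse mult_ac)
    have "cis (pi / 2) = \<i>" "cis (- pi / 2) = - \<i>"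
      by (simp_all add: complex_eq_iff)
    then have E: "?E (pi / 2) t = damped_power (real k) p (ln t) * exp (- (\<i> * of_real (x * t)))"
      "?E (- pi / 2) t = damped_power (real k) p (ln t) * exp (\<i> * of_real (x * t))"
      by (simp_all add: mult_ac)
    have "complex_of_real (cos (x * t)) = (exp (\<i> * of_real (x * t)) + exp (- (\<i> * of_real (x * t)))) / 2"
      by (metis cos_exp_eq cos_of_real)
    then have "(?E (pi / 2) t + ?E (- pi / 2) t) * (1 / 2) = damped_power (real k) p (ln t) * of_real (cos (x * t))"
      unfolding E by (simp only: times_divide_eq_right distrib_left mult_1_right add.commute)
    then show ?thesis
      unfolding D by (simp only: times_divide_eq_left of_real_mult) (simp only: p_def)
  qed
  show ?thesis
    using main unfolding val by (rule has_integral_eq[rotated]) (rule integrand)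
qed

end
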